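(* Let $\alpha\in(0,1]$, let $X$ be a Banach space, let $\{T_\alpha(t)\}_{t\ge0}\subset\mathcal L(X)$ be a $C_0$--$\alpha$--semigroup on $X$, and define $T(s)=T_\alpha\bigl((\alpha s)^{1/\alpha}\bigr)$ for $s\ge0$. If $A$ and $B$ denote respectively the $\alpha$-generator of $\{T_\alpha(t)\}_{t\ge0}$ and the (classical infinitesimal) generator of $\{T(s)\}_{s\ge0}$, then $$D(A)=D(B)\quad\text{and}\quad Ax=Bx\ \text{ for all } x\in D(A).$$
   Context: $\mathcal L(X)$ is the space of bounded linear operators on $X$. An $\alpha$-semigroup on $X$ is a family $\{S(t)\}_{t\ge0}\subset\mathcal L(X)$ with $S(0)=\mathrm{Id}$ and $S\bigl((r+q)^{1/\alpha}\bigr)=S\bigl(r^{1/\alpha}\bigr)S\bigl(q^{1/\alpha}\bigr)$ for all $r,q\ge0$. It is a $C_0$--$\alpha$--semigroup if moreover $\lim_{t\to0^+}S(t)x=x$ for every $x\in X$. (For $\alpha=1$ this is a classical $C_0$-semigroup.) The conformable derivative of order $\alpha$ of a function $v$ at $t>0$ is $\mathcal D_t^\alpha v(t)=\lim_{h\to0}\frac{v(t+h\,t^{1-\alpha})-v(t)}{h}$, when the limit exists. The $\alpha$-generator $\mathcal A$ of $\{S(t)\}_{t\ge0}$ is defined by $D(\mathcal A)=\{x\in X:\ \lim_{t\to0^+}\mathcal D_t^\alpha S(t)x\text{ exists}\}$ and $\mathcal Ax=\lim_{t\to0^+}\mathcal D_t^\alpha S(t)x$. The classical generator of a $C_0$-semigroup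 $\{T(s)\}_{s\ge0}$ is $Bx=\lim_{s\to0^+}\frac{T(s)x-x}{s}$, with domain the set of $x$ for which the limit exists. *)

theory Defs
  imports "HOL-Analysis.Analysis"
begin

text \<open>
  Operator families indexed by $t \ge 0$ are total functions on the reals; only their values at
  nonnegative arguments matter below.
\<close>

definition alpha_semigroup :: "real \<Rightarrow> (real \<Rightarrow> 'a::real_normed_vector \<Rightarrow>\<^sub>L 'a) \<Rightarrow> bool" where
  "alpha_semigroup \<alpha> S \<longleftrightarrow>
     S 0 = id_blinfun \<and>
     (\<forall>r\<ge>0. \<forall>q\<ge>0. S ((r + q) powr (1 / \<alpha>)) = S (r powr (1 / \<alpha>)) o\<^sub>L S (q powr (1 / \<alpha>)))"

definition C0_alpha_semigroup :: "real \<Rightarrow> (real \<Rightarrow> 'a::real_normed_vector \<Rightarrow>\<^sub>L 'a) \<Rightarrow> bool" where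
  "C0_alpha_semigroup \<alpha> S \<longleftrightarrow>
     alpha_semigroup \<alpha> S \<and>
     (\<forall>x. ((\<lambda>t. blinfun_apply (S t) x) \<longlongrightarrow> x) (at_right 0))"

definition has_conformable_derivative ::
    "real \<Rightarrow> (real \<Rightarrow> 'a::real_normed_vector) \<Rightarrow> 'a \<Rightarrow> real \<Rightarrow> bool" where
  "has_conformable_derivative \<alpha> v D t \<longleftrightarrow>
     ((\<lambda>h. (v (t + h * t powr (1 - \<alpha>)) - v t) /\<^sub>R h) \<longlongrightarrow> D) (at 0)"

definition conformable_differentiable ::
    "real \<Rightarrow> (real \<Rightarrow> 'a::real_normed_vector) \<Rightarrow> real \<Rightarrow> bool" where
  "conformable_differentiable \<alpha> v t \<longleftrightarrow> (\<exists>D. has_conformable_derivative \<alpha> v D t)"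

definition conformable_deriv ::
    "real \<Rightarrow> (real \<Rightarrow> 'a::real_normed_vector) \<Rightarrow> real \<Rightarrow> 'a" where
  "conformable_deriv \<alpha> v t = (THE D. has_conformable_derivative \<alpha> v D t)"

text \<open>
  The limit defining the \<open>\<alpha>\<close>-generator can exist only if the derivative itself exists on some
  interval to the right of 0. As \<^const>\<open>conformable_deriv\<close> is total, this is required explicitly.
  The two generators are partial operators: each function is meaningful only on its domain.
\<close>

definition alpha_generator_domain ::
    "real \<Rightarrow> (real \<Rightarrow> 'a::real_normed_vector \<Rightarrow>\<^sub>L 'a) \<Rightarrow> 'a set" where
  "alpha_generator_domain \<alpha> S =
     {x. (\<forall>\<^sub>F t in at_right 0. conformable_differentiable \<alpha> (\<lambda>t. blinfun_apply (S t) x) t) \<and>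
         (\<exists>y. ((\<lambda>t. conformable_deriv \<alpha> (\<lambda>t. blinfun_apply (S t) x) t) \<longlongrightarrow> y) (at_right 0))}"

definition alpha_generator ::
    "real \<Rightarrow> (real \<Rightarrow> 'a::real_normed_vector \<Rightarrow>\<^sub>L 'a) \<Rightarrow> 'a \<Rightarrow> 'a" where
  "alpha_generator \<alpha> S x =
     Lim (at_right 0) (\<lambda>t. conformable_deriv \<alpha> (\<lambda>t. blinfun_apply (S t) x) t)"

definition generator_domain :: "(real \<Rightarrow> 'a::real_normed_vector \<Rightarrow>\<^sub>L 'a) \<Rightarrow> 'a set" where
  "generator_domain T =
     {x. \<exists>y. ((\<lambda>s. (blinfun_apply (T s) x - x) /\<^sub>R s) \<longlongrightarrow> y) (at_right 0)}"

definition generator :: "(real \<Rightarrow> 'a::real_normed_vector \<Rightarrow>\<^sub>L 'a) \<Rightarrow> 'a \<Rightarrow> 'a" where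
  "generator T x = Lim (at_right 0) (\<lambda>s. (blinfun_apply (T s) x - x) /\<^sub>R s)"

text \<open>
  The rescaled family is a classical \<open>C\<^sub>0\<close>-semigroup, so that it makes sense to speak of its
  generator.
\<close>

lemma C0_alpha_semigroup_rescale:
  assumes \<alpha>: "0 < \<alpha>"
    and S: "C0_alpha_semigroup \<alpha> S"
    and T: "\<And>s. s \<ge> 0 \<Longrightarrow> T s = S ((\<alpha> * s) powr (1 / \<alpha>))"
  shows "C0_alpha_semigroup 1 T"
  unfolding C0_alpha_semigroup_def alpha_semigroup_def
proof (intro conjI allI impI)
  show "T 0 = id_blinfun"
    using S T[of 0] by (simp add: C0_alpha_semigroup_def alpha_semigroup_def)
next
  fix r q :: real assume rq: "0 \<le> r" "0 \<le> q"
  have "S ((\<alpha> * r + \<alpha> * q) powr (1 / \<alpha>)) = S ((\<alpha> * r) powr (1 / \<alpha>)) o\<^sub>L S ((\<alpha> * q) powr (1 / \<alpha>))"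
    using S rq \<alpha> by (simp add: C0_alpha_semigroup_def alpha_semigroup_def)
  then show "T ((r + q) powr (1 / 1)) = T (r powr (1 / 1)) o\<^sub>L T (q powr (1 / 1))"
    using rq by (simp add: T distrib_left)
next
  fix x
  have *: "filterlim (\<lambda>s. (\<alpha> * s) powr (1 / \<alpha>)) (at_right 0) (at_right 0)"
  proof (rule tendsto_imp_filterlim_at_right)
    have "((\<lambda>s. (\<alpha> * s) powr (1 / \<alpha>)) \<longlongrightarrow> (\<alpha> * 0) powr (1 / \<alpha>)) (at_right 0)"
    proof (rule tendsto_powr')
      show "\<alpha> * 0 \<noteq> 0 \<or> 0 < 1 / \<alpha> \<and> (\<forall>\<^sub>F s in at_right 0. 0 \<le> \<alpha> * s)"
        using \<alpha> by (auto simp: eventually_at_right_less intro: eventually_mono[OF eventually_at_right_less])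
    qed (intro tendsto_intros)+
    then show "((\<lambda>s. (\<alpha> * s) powr (1 / \<alpha>)) \<longlongrightarrow> 0) (at_right 0)" by simp
    show "\<forall>\<^sub>F s in at_right 0. (\<alpha> * s) powr (1 / \<alpha>) > 0"
      using \<alpha> by (intro eventually_mono[OF eventually_at_right_less]) auto
  qed
  have "((\<lambda>s. blinfun_apply (S ((\<alpha> * s) powr (1 / \<alpha>))) x) \<longlongrightarrow> x) (at_right 0)"
    using S filterlim_compose[OF _ *] by (auto simp: C0_alpha_semigroup_def)
  then show "((\<lambda>s. blinfun_apply (T s) x) \<longlongrightarrow> x) (at_right 0)"
    by (rule Lim_transform_eventually)
       (auto simp: T intro: eventually_mono[OF eventually_at_right_less])
qed

end

theory Submission
  imports Defs
begin

text \<open>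
  The substitution \<open>s = t powr \<alpha> / \<alpha>\<close> turns the conformable derivative of \<open>t \<mapsto> T\<^sub>\<alpha> t x\<close> at \<open>t > 0\<close>
  into the ordinary two-sided derivative of the orbit \<open>s \<mapsto> T s x\<close>, so \<open>A x\<close> is the
  limit of that derivative at \<open>0\<close>. If this limit exists, the mean value inequality shows that
  it is also the limit of the difference quotients at \<open>0\<close>. Conversely, if \<open>B x = y\<close>, the orbit has derivative
  \<open>T s y\<close> at small \<open>s > 0\<close>, which tends to \<open>y\<close>; differentiability from the left needs that \<open>T\<close> is
  bounded near \<open>0\<close>, which follows from the uniform boundedness principle.
\<close>

section \<open>Uniform boundedness via Baire category\<close>

lemma uniform_boundedness:
  fixes A :: "('a::banach \<Rightarrow>\<^sub>L 'b::real_normed_vector) set"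
  assumes pw: "\<And>x. bounded ((\<lambda>f. blinfun_apply f x) ` A)"
  shows "bounded A"
proof -
  \<comment> \<open>The Baire argument runs over the level sets \<open>C n\<close>: they are closed,
    and pointwise boundedness makes them cover the space.\<close>
  define C where "C n = {x. \<forall>f\<in>A. norm (blinfun_apply f x) \<le> real n}" for n :: nat
  have closed_C: "closed (C n)" for n
  proof -
    have "C n = (\<Inter>f\<in>A. {x. norm (blinfun_apply f x) \<le> real n})"
      by (auto simp: C_def)
    moreover have "closed {x. norm (blinfun_apply f x) \<le> real n}" for f :: "'a \<Rightarrow>\<^sub>L 'b"
      by (intro closed_Collect_le continuous_intros)
    ultimately show ?thesis by auto
  qed
  have cover: "(\<Union>n. C n) = UNIV"
  proof -
    have "\<exists>n. x \<in> C n" for x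
    proof -
      obtain b where b: "\<And>f. f \<in> A \<Longrightarrow> norm (blinfun_apply f x) \<le> b"
        using pw[of x] by (auto simp: bounded_iff)
      obtain n :: nat where "b \<le> real n" using real_arch_simple by blast
      then have "x \<in> C n" unfolding C_def using b order_trans by blast
      then show ?thesis ..
    qed
    then show ?thesis by auto
  qed
  have "\<exists>n. interior (C n) \<noteq> {}"
  proof (rule ccontr)
    assume "\<not> ?thesis"
    \<comment> \<open>\<open>Met_TC\<close> is the metric space of the type class, complete because
      \<open>'a\<close> is Banach. Closed sets with empty interior would have a countable union with
      empty interior, yet the union is everything.\<close>
    then have "Met_TC.mtopology interior_of (\<Union>(range C)) = {}"
      using closed_C
      by (intro Met_TC.metric_Baire_category_alt) (auto simp: mcomplete_iff_complete complete_UNIV)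
    then show False using cover by simp
  qed
  then obtain n x0 where "x0 \<in> interior (C n)" by auto
  then obtain r where r: "r > 0" "cball x0 r \<subseteq> C n"
    by (auto simp: mem_interior_cball)
  have "norm f \<le> 2 * real n / r" if f: "f \<in> A" for f
  proof (rule norm_blinfun_bound)
    fix y
    show "norm (blinfun_apply f y) \<le> 2 * real n / r * norm y"
    proof (cases "y = 0")
      case False
      \<comment> \<open>Scaling y to length r keeps \<open>x0 + c *\<^sub>R y\<close> in the ball;
        subtracting the value at the centre costs the factor 2.\<close>
      define c where "c = r / norm y"
      have c: "c > 0" using False r by (simp add: c_def)
      have "x0 + c *\<^sub>R y \<in> cball x0 r" "x0 \<in> cball x0 r"
        using r False by (auto simp: c_def dist_norm)
      then have "x0 + c *\<^sub>R y \<in> C n" "x0 \<in> C n"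
        using r(2) by blast+
      then have "norm (blinfun_apply f (x0 + c *\<^sub>R y)) \<le> n" "norm (blinfun_apply f x0) \<le> n"
        using f by (auto simp: C_def)
      moreover have "c *\<^sub>R blinfun_apply f y = blinfun_apply f (x0 + c *\<^sub>R y) - blinfun_apply f x0"
        by (simp add: blinfun.bilinear_simps)
      ultimately have "norm (c *\<^sub>R blinfun_apply f y) \<le> 2 * real n"
        by (smt (verit) norm_triangle_ineq4)
      then show ?thesis using c False r by (simp add: c_def field_simps)
    qed simp
  qed (use r in simp)
  then show ?thesis by (auto simp: bounded_iff)
qed

section \<open>Derivatives and difference quotients of vector-valued functions\<close>

text \<open>Brings the derivative into the form of the conformable quotient and lets its two
  one-sided limits be treated separately.\<close>

lemma has_vector_derivative_iff_tendsto:
  fixes f :: "real \<Rightarrow> 'a::real_normed_vector"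
  shows "(f has_vector_derivative D) (at x) \<longleftrightarrow>
    ((\<lambda>h. (f (x + h) - f x) /\<^sub>R h) \<longlongrightarrow> D) (at 0)"
proof -
  have "((\<lambda>h. (f (x + h) - f x) /\<^sub>R h) \<longlongrightarrow> D) (at 0) \<longleftrightarrow>
      ((\<lambda>h. norm ((f (x + h) - f x) /\<^sub>R h - D)) \<longlongrightarrow> 0) (at 0)"
    unfolding tendsto_norm_zero_iff by (rule LIM_zero_iff[symmetric])
  also have "\<dots> \<longleftrightarrow> ((\<lambda>h. norm (f (x + h) - f x - h *\<^sub>R D) / norm h) \<longlongrightarrow> 0) (at 0)"
  proof (rule filterlim_cong[OF refl refl])
    have "norm ((f (x + h) - f x) /\<^sub>R h - D) = norm (f (x + h) - f x - h *\<^sub>R D) / norm h"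
      if "h \<noteq> 0" for h
    proof -
      have "(f (x + h) - f x) /\<^sub>R h - D = (f (x + h) - f x - h *\<^sub>R D) /\<^sub>R h"
        using that by (simp add: scaleR_diff_right)
      then show ?thesis by (simp add: divide_inverse mult.commute)
    qed
    then show "\<forall>\<^sub>F h in at 0. norm ((f (x + h) - f x) /\<^sub>R h - D) =
        norm (f (x + h) - f x - h *\<^sub>R D) / norm h"
      unfolding eventually_at_filter by (intro always_eventually) blast
  qed
  finally show ?thesis
    by (simp add: has_vector_derivative_def has_derivative_at bounded_linear_scaleR_left)
qed

text \<open>The mean value inequality for \<open>u s - s *\<^sub>R y\<close>, whose derivative
  \<open>u' s - y\<close> is small near 0. Derivatives are available only for s > 0; right
  continuity supplies the endpoint 0.\<close>

lemma tendsto_difference_quotient_at_right: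
  fixes u :: "real \<Rightarrow> 'a::real_normed_vector"
  assumes cont: "(u \<longlongrightarrow> u 0) (at_right 0)"
    and deriv: "\<forall>\<^sub>F s in at_right 0. (u has_vector_derivative u' s) (at s)"
    and lim: "(u' \<longlongrightarrow> y) (at_right 0)"
  shows "((\<lambda>s. (u s - u 0) /\<^sub>R s) \<longlongrightarrow> y) (at_right 0)"
proof (rule tendstoI)
  fix e :: real assume e: "e > 0"
  \<comment> \<open>Half of e, because the mean value inequality gives only \<le> while the
    conclusion needs a strict bound.\<close>
  have "\<forall>\<^sub>F s in at_right 0. (u has_vector_derivative u' s) (at s) \<and> dist (u' s) y < e / 2"
    using deriv tendstoD[OF lim, of "e / 2"] e by (auto intro: eventually_conj)
  then obtain d where d: "d > 0"
      "\<And>s. 0 < s \<Longrightarrow> s < d \<Longrightarrow> (u has_vector_derivative u' s) (at s) \<and> dist (u' s) y < e / 2"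
    by (auto simp: eventually_at_right_field)
  have "dist ((u s - u 0) /\<^sub>R s) y < e" if s: "0 < s" "s < d" for s
  proof -
    have "norm ((u s - s *\<^sub>R y) - (u 0 - 0 *\<^sub>R y)) \<le> e / 2 * s - e / 2 * 0"
    proof (rule differentiable_bound_general[OF s(1), where f' = "\<lambda>r. u' r - y"
          and \<phi>' = "\<lambda>_. e / 2"])
      have "continuous (at r within {0..s}) u" if "r \<in> {0..s}" for r
      proof (cases "r = 0")
        case True
        then show ?thesis
          using cont s by (auto simp: continuous_within at_within_Icc_at_right)
      next
        case False
        then show ?thesis
          using d(2)[of r] s that
          by (auto intro: continuous_at_imp_continuous_at_within has_vector_derivative_continuous)
      qed
      then show "continuous_on {0..s} (\<lambda>s. u s - s *\<^sub>R y)"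
        by (intro continuous_intros) (simp add: continuous_on_eq_continuous_within)
      show "((\<lambda>s. u s - s *\<^sub>R y) has_vector_derivative u' r - y) (at r)" if "0 < r" "r < s" for r
        using d(2)[of r] s that by (auto intro!: derivative_eq_intros)
      show "norm (u' r - y) \<le> e / 2" if "0 < r" "r < s" for r
        using d(2)[of r] s that by (auto simp: dist_norm)
    qed (auto intro!: continuous_intros derivative_eq_intros)
    then have le: "norm (u s - u 0 - s *\<^sub>R y) \<le> e / 2 * s"
      by (simp add: algebra_simps)
    have "(u s - u 0) /\<^sub>R s - y = (u s - u 0 - s *\<^sub>R y) /\<^sub>R s"
      using s by (simp add: scaleR_diff_right)
    then have "dist ((u s - u 0) /\<^sub>R s) y = norm (u s - u 0 - s *\<^sub>R y) / s"
      using s by (simp add: dist_norm divide_inverse mult.commute)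
    also have "\<dots> \<le> e / 2" using le s by (simp add: field_simps)
    finally show ?thesis using e by simp
  qed
  then show "\<forall>\<^sub>F s in at_right 0. dist ((u s - u 0) /\<^sub>R s) y < e"
    using d(1) by (auto simp: eventually_at_right_field)
qed

section \<open>Classical semigroups and the derivatives of their orbits\<close>

lemma C0_semigroup_add:
  assumes "C0_alpha_semigroup 1 T" "0 \<le> r" "0 \<le> q"
  shows "T (r + q) = T r o\<^sub>L T q"
  using assms by (fastforce simp: C0_alpha_semigroup_def alpha_semigroup_def)

lemma C0_semigroup_tendsto:
  assumes "C0_alpha_semigroup 1 T"
  shows "((\<lambda>s. blinfun_apply (T s) x) \<longlongrightarrow> x) (at_right 0)"
  using assms by (simp add: C0_alpha_semigroup_def)

text \<open>Along any sequence of times tending to 0 from the right, strong continuity makes each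
  orbit converge, hence stay bounded; unbounded operator norms would contradict uniform
  boundedness.\<close>

lemma C0_semigroup_locally_bounded:
  fixes T :: "real \<Rightarrow> 'a::banach \<Rightarrow>\<^sub>L 'a"
  assumes T: "C0_alpha_semigroup 1 T"
  obtains \<delta> M where "\<delta> > 0" "\<And>s. 0 < s \<Longrightarrow> s < \<delta> \<Longrightarrow> norm (T s) \<le> M"
proof -
  \<comment> \<open>One n controls both the bound and the interval length, so the negation yields a
    single sequence tending to 0 with unbounded norms.\<close>
  have "\<exists>n::nat. \<forall>s. 0 < s \<and> s < 1 / Suc n \<longrightarrow> norm (T s) \<le> n"
  proof (rule ccontr)
    assume "\<not> ?thesis"
    then have "\<forall>n::nat. \<exists>s. 0 < s \<and> s < 1 / Suc n \<and> norm (T s) > n"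
      by (auto simp: not_le)
    then obtain s where s: "\<And>n::nat. 0 < s n" "\<And>n::nat. s n < 1 / Suc n"
      "\<And>n::nat. norm (T (s n)) > n" by metis
    have "s \<longlonglongrightarrow> 0"
      by (rule tendsto_sandwich[OF _ _ tendsto_const LIMSEQ_inverse_real_of_nat])
         (use s in \<open>auto intro!: always_eventually less_imp_le simp: inverse_eq_divide\<close>)
    then have "filterlim s (at_right 0) sequentially"
      using s(1) by (auto intro: tendsto_imp_filterlim_at_right)
    then have "(\<lambda>n. blinfun_apply (T (s n)) x) \<longlonglongrightarrow> x" for x
      using filterlim_compose[OF C0_semigroup_tendsto[OF T]] by blast
    then have "bounded (range (\<lambda>n. blinfun_apply (T (s n)) x))" for x
      by (rule convergent_imp_bounded)
    then have "bounded (range (\<lambda>n. T (s n)))"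
      by (intro uniform_boundedness) (simp add: image_image)
    then obtain b where b: "\<And>n. norm (T (s n)) \<le> b" by (auto simp: bounded_iff)
    obtain n :: nat where "b \<le> n" using real_arch_simple by blast
    with b[of n] s(3)[of n] show False by simp
  qed
  then obtain n :: nat where "\<And>s. 0 < s \<Longrightarrow> s < 1 / Suc n \<Longrightarrow> norm (T s) \<le> n" by blast
  then show thesis by (intro that[of "1 / Suc n" n]) auto
qed

text \<open>Both one-sided derivatives come from the semigroup law. On the right the fixed
  continuous operator \<open>T s\<close> is factored out; on the left the factor
  \<open>T (s - h)\<close> varies with h and is controlled by the local bound.\<close>

lemma C0_semigroup_orbit_derivative:
  fixes T :: "real \<Rightarrow> 'a::banach \<Rightarrow>\<^sub>L 'a"
  assumes T: "C0_alpha_semigroup 1 T"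
    and lim: "((\<lambda>s. (blinfun_apply (T s) x - x) /\<^sub>R s) \<longlongrightarrow> y) (at_right 0)"
  shows "\<forall>\<^sub>F s in at_right 0.
    ((\<lambda>s. blinfun_apply (T s) x) has_vector_derivative blinfun_apply (T s) y) (at s)"
proof -
  obtain \<delta> M where \<delta>: "\<delta> > 0" and M: "\<And>s. 0 < s \<Longrightarrow> s < \<delta> \<Longrightarrow> norm (T s) \<le> M"
    using C0_semigroup_locally_bounded[OF T] by metis
  have "((\<lambda>s. blinfun_apply (T s) x) has_vector_derivative blinfun_apply (T s) y) (at s)"
    if s: "0 < s" "s < \<delta>" for s
    unfolding has_vector_derivative_iff_tendsto
  proof (rule filterlim_split_at)
    have "((\<lambda>h. blinfun_apply (T s) ((blinfun_apply (T h) x - x) /\<^sub>R h)) \<longlongrightarrow>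
        blinfun_apply (T s) y) (at_right 0)"
      by (intro tendsto_intros lim)
    then show "((\<lambda>h. (blinfun_apply (T (s + h)) x - blinfun_apply (T s) x) /\<^sub>R h) \<longlongrightarrow>
        blinfun_apply (T s) y) (at_right 0)"
      by (rule Lim_transform_eventually)
        (use s in \<open>auto simp: C0_semigroup_add[OF T] blinfun.bilinear_simps
          intro!: eventually_mono[OF eventually_at_right_less]\<close>)
    \<comment> \<open>Writing \<open>T s = T (s - h) T h\<close>, the error of the left difference quotient is \<open>T (s - h) (g h)\<close>,
        so only a bound on \<open>T (s - h)\<close> is needed, not its convergence.\<close>
    define g where "g h = (blinfun_apply (T h) x - x) /\<^sub>R h - blinfun_apply (T h) y" for h
    have "(g \<longlongrightarrow> y - y) (at_right 0)"
      unfolding g_def by (intro tendsto_intros lim C0_semigroup_tendsto[OF T])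
    then have g0: "((\<lambda>h. M * norm (g h)) \<longlongrightarrow> 0) (at_right 0)"
      by (auto intro: tendsto_mult_right_zero tendsto_norm_zero)
    \<comment> \<open>The left quotient is written with \<open>- h\<close> for h > 0, so that its
      limit is again one in \<open>at_right 0\<close>; the reflection is undone at the end.\<close>
    have "((\<lambda>h. (blinfun_apply (T (s + - h)) x - blinfun_apply (T s) x) /\<^sub>R (- h) -
        blinfun_apply (T s) y) \<longlongrightarrow> 0) (at_right 0)"
    proof (rule Lim_null_comparison[OF _ g0])
      have "norm ((blinfun_apply (T (s + - h)) x - blinfun_apply (T s) x) /\<^sub>R (- h) -
          blinfun_apply (T s) y) \<le> M * norm (g h)" if h: "0 < h" "h < s" for h
      proof -
        have "T s = T (s - h) o\<^sub>L T h"
          using C0_semigroup_add[OF T, of "s - h" h] h by simp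
        then have "(blinfun_apply (T (s + - h)) x - blinfun_apply (T s) x) /\<^sub>R (- h) -
            blinfun_apply (T s) y = blinfun_apply (T (s - h)) (g h)"
          by (simp add: g_def blinfun.bilinear_simps scaleR_diff_right)
        also have "norm \<dots> \<le> norm (T (s - h)) * norm (g h)" by (rule norm_blinfun)
        \<comment> \<open>Here \<open>s - h\<close> lies between 0 and \<delta>, where M bounds the
          operators.\<close>
        also have "\<dots> \<le> M * norm (g h)"
          using M[of "s - h"] h s by (intro mult_right_mono) auto
        finally show ?thesis .
      qed
      then show "\<forall>\<^sub>F h in at_right 0. norm ((blinfun_apply (T (s + - h)) x -
          blinfun_apply (T s) x) /\<^sub>R (- h) - blinfun_apply (T s) y) \<le> M * norm (g h)"
        using s(1) by (auto simp: eventually_at_right_field)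
    qed
    then have "((\<lambda>h. (blinfun_apply (T (s + - h)) x - blinfun_apply (T s) x) /\<^sub>R (- h)) \<longlongrightarrow>
        blinfun_apply (T s) y) (at_right 0)"
      by (simp only: LIM_zero_iff)
    then show "((\<lambda>h. (blinfun_apply (T (s + h)) x - blinfun_apply (T s) x) /\<^sub>R h) \<longlongrightarrow>
        blinfun_apply (T s) y) (at_left 0)"
      by (subst filterlim_at_left_to_right) simp
  qed
  then show ?thesis using \<delta> unfolding eventually_at_right_field by blast
qed

text \<open>Meeting point of the two generators: the right-hand side involves only derivatives of
  the orbit at s > 0, which survive the change of time variable.\<close>

lemma C0_semigroup_generator_iff:
  fixes T :: "real \<Rightarrow> 'a::banach \<Rightarrow>\<^sub>L 'a"
  assumes T: "C0_alpha_semigroup 1 T"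
  shows "((\<lambda>s. (blinfun_apply (T s) x - x) /\<^sub>R s) \<longlongrightarrow> y) (at_right 0) \<longleftrightarrow>
    (\<exists>u'. (\<forall>\<^sub>F s in at_right 0. ((\<lambda>s. blinfun_apply (T s) x) has_vector_derivative u' s) (at s)) \<and>
      (u' \<longlongrightarrow> y) (at_right 0))"
proof
  assume lim: "((\<lambda>s. (blinfun_apply (T s) x - x) /\<^sub>R s) \<longlongrightarrow> y) (at_right 0)"
  show "\<exists>u'. (\<forall>\<^sub>F s in at_right 0. ((\<lambda>s. blinfun_apply (T s) x) has_vector_derivative u' s) (at s)) \<and>
      (u' \<longlongrightarrow> y) (at_right 0)"
    using conjI[OF C0_semigroup_orbit_derivative[OF T lim] C0_semigroup_tendsto[OF T]]
    by (rule exI[of _ "\<lambda>s. blinfun_apply (T s) y"])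
next
  assume "\<exists>u'. (\<forall>\<^sub>F s in at_right 0. ((\<lambda>s. blinfun_apply (T s) x) has_vector_derivative u' s) (at s)) \<and>
      (u' \<longlongrightarrow> y) (at_right 0)"
  then obtain u' where u': "\<forall>\<^sub>F s in at_right 0.
      ((\<lambda>s. blinfun_apply (T s) x) has_vector_derivative u' s) (at s)" "(u' \<longlongrightarrow> y) (at_right 0)"
    by blast
  have T0: "blinfun_apply (T 0) x = x"
    using T by (simp add: C0_alpha_semigroup_def alpha_semigroup_def)
  show "((\<lambda>s. (blinfun_apply (T s) x - x) /\<^sub>R s) \<longlongrightarrow> y) (at_right 0)"
    using tendsto_difference_quotient_at_right[OF _ u'] C0_semigroup_tendsto[OF T, of x]
    unfolding T0 by blast
qed

section \<open>The conformable derivative under change of variable\<close>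

text \<open>Chain rule in both directions: the factor \<open>t powr (1 - \<alpha>)\<close> in the
  increment cancels the derivative \<open>t powr (\<alpha> - 1)\<close> of the substitution, so D is
  not rescaled.\<close>

lemma has_conformable_derivative_iff:
  fixes v :: "real \<Rightarrow> 'a::real_normed_vector"
  assumes \<alpha>: "0 < \<alpha>" and t: "0 < t"
    and v: "\<And>r. 0 < r \<Longrightarrow> v r = u (r powr \<alpha> / \<alpha>)"
  shows "has_conformable_derivative \<alpha> v D t \<longleftrightarrow> (u has_vector_derivative D) (at (t powr \<alpha> / \<alpha>))"
proof -
  define c where "c = t powr (1 - \<alpha>)"
  define s where "s = t powr \<alpha> / \<alpha>"
  \<comment> \<open>\<open>\<phi>\<close> is the substitution in terms of the increment h and
    \<open>\<psi>\<close> its local inverse; with \<open>w\<close> below,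
    \<open>u \<circ> \<phi>\<close> is \<open>w\<close> near 0 and \<open>w \<circ> \<psi>\<close>
    is \<open>u\<close> near \<open>s\<close>.\<close>
  define \<phi> where "\<phi> h = (t + h * c) powr \<alpha> / \<alpha>" for h
  define \<psi> where "\<psi> r = ((\<alpha> * r) powr (1 / \<alpha>) - t) / c" for r
  have c: "c > 0" and s: "s > 0" using t \<alpha> by (auto simp: c_def s_def)
  have \<phi>0: "\<phi> 0 = s" and \<psi>s: "\<psi> s = 0" using \<alpha> t by (auto simp: \<phi>_def s_def \<psi>_def powr_powr)
  have \<phi>': "(\<phi> has_vector_derivative 1) (at 0)"
  proof -
    have "(\<phi> has_real_derivative \<alpha> * t powr (\<alpha> - 1) * c / \<alpha>) (at 0)"
      unfolding \<phi>_def using t \<alpha> by (auto intro!: derivative_eq_intros)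
    moreover have "\<alpha> * t powr (\<alpha> - 1) * c / \<alpha> = 1"
      using \<alpha> t by (simp add: c_def powr_add[symmetric])
    ultimately show ?thesis by (simp add: has_real_derivative_iff_has_vector_derivative)
  qed
  have \<psi>': "(\<psi> has_vector_derivative 1) (at s)"
  proof -
    have "(\<psi> has_real_derivative (1 / \<alpha> * (\<alpha> * s) powr (1 / \<alpha> - 1) * \<alpha>) / c) (at s)"
      unfolding \<psi>_def using s \<alpha> c by (auto intro!: derivative_eq_intros)
    \<comment> \<open>By definition \<open>\<alpha> * s\<close> is \<open>t powr \<alpha>\<close>,
      and \<alpha> (1 / \<alpha> - 1) = 1 - \<alpha>.\<close>
    moreover have "(\<alpha> * s) powr (1 / \<alpha> - 1) = c"
      using \<alpha> t by (simp add: c_def s_def powr_powr algebra_simps)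
    ultimately show ?thesis
      using \<alpha> c by (simp add: has_real_derivative_iff_has_vector_derivative)
  qed
  define w where "w h = v (t + h * c)" for h
  have "has_conformable_derivative \<alpha> v D t \<longleftrightarrow> (w has_vector_derivative D) (at 0)"
    by (simp add: has_conformable_derivative_def has_vector_derivative_iff_tendsto w_def c_def)
  also have "\<dots> \<longleftrightarrow> (u has_vector_derivative D) (at s)"
  proof
    assume "(w has_vector_derivative D) (at 0)"
    then have "(w \<circ> \<psi> has_vector_derivative 1 *\<^sub>R D) (at s)"
      using \<psi>' \<psi>s by (intro vector_diff_chain_at) auto
    then have "(w \<circ> \<psi> has_vector_derivative D) (at s)" by simp
    then show "(u has_vector_derivative D) (at s)"
      by (rule has_vector_derivative_transform_within_open[where S = "{0<..}"])
         (use s \<alpha> c in \<open>auto simp: w_def \<psi>_def v powr_powr\<close>)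
  next
    assume "(u has_vector_derivative D) (at s)"
    then have "(u \<circ> \<phi> has_vector_derivative 1 *\<^sub>R D) (at 0)"
      using \<phi>' \<phi>0 by (intro vector_diff_chain_at) auto
    then have "(u \<circ> \<phi> has_vector_derivative D) (at 0)" by simp
    \<comment> \<open>\<open>{- t / c<..}\<close> is exactly where \<open>t + h * c > 0\<close>, the
      range in which \<open>v\<close> is given by \<open>u\<close>.\<close>
    then show "(w has_vector_derivative D) (at 0)"
      by (rule has_vector_derivative_transform_within_open[where S = "{- t / c<..}"])
         (use t \<alpha> c in \<open>auto simp: w_def \<phi>_def v field_simps\<close>)
  qed
  finally show ?thesis by (simp add: s_def)
qed

lemma has_conformable_derivative_unique:
  fixes v :: "real \<Rightarrow> 'a::real_normed_vector"
  assumes "has_conformable_derivative \<alpha> v D t" "has_conformable_derivative \<alpha> v E t"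
  shows "D = E"
  using assms unfolding has_conformable_derivative_def
  by (rule tendsto_unique[OF trivial_limit_at])

lemma has_conformable_derivative_imp_deriv:
  fixes v :: "real \<Rightarrow> 'a::real_normed_vector"
  assumes "has_conformable_derivative \<alpha> v D t"
  shows "conformable_deriv \<alpha> v t = D"
  unfolding conformable_deriv_def
  using assms has_conformable_derivative_unique by blast

lemma conformable_deriv_works:
  fixes v :: "real \<Rightarrow> 'a::real_normed_vector"
  assumes "conformable_differentiable \<alpha> v t"
  shows "has_conformable_derivative \<alpha> v (conformable_deriv \<alpha> v t) t"
  using assms has_conformable_derivative_imp_deriv
  unfolding conformable_differentiable_def by blast

text \<open>Serves the substitution with (a, b, c) = (1, \<alpha>, \<alpha>) and its inverse with
  (\<alpha>, 1 / \<alpha>, 1).\<close>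

lemma filterlim_powr_at_right_0:
  fixes a b :: real
  assumes "a > 0" "b > 0" "c > 0"
  shows "filterlim (\<lambda>t. (a * t) powr b / c) (at_right 0) (at_right 0)"
proof (rule tendsto_imp_filterlim_at_right)
  have pos: "\<forall>\<^sub>F t in at_right 0. a * t > 0"
    using eventually_at_right_less[of 0] by eventually_elim (use assms in simp)
  then have "((\<lambda>t. (a * t) powr b) \<longlongrightarrow> (a * 0) powr b) (at_right 0)"
    using assms
    by (intro tendsto_powr' tendsto_intros) (auto elim: eventually_mono)
  then have "((\<lambda>t. (a * t) powr b / c) \<longlongrightarrow> (a * 0) powr b / c) (at_right 0)"
    using assms by (intro tendsto_divide tendsto_const) auto
  then show "((\<lambda>t. (a * t) powr b / c) \<longlongrightarrow> 0) (at_right 0)" by simp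
  show "\<forall>\<^sub>F t in at_right 0. (a * t) powr b / c > 0"
    using eventually_at_right_less[of 0] by eventually_elim (use assms in simp)
qed

text \<open>The substitution and its inverse both tend to 0 from the right, which gives an equality
  of filters and not just one inequality; eventual properties and limits then transfer both
  ways.\<close>

lemma filtermap_powr_at_right_0:
  assumes \<alpha>: "(0::real) < \<alpha>"
  shows "filtermap (\<lambda>t. t powr \<alpha> / \<alpha>) (at_right 0) = at_right 0"
proof (rule filtermap_fun_inverse)
  show "filterlim (\<lambda>s. (\<alpha> * s) powr (1 / \<alpha>)) (at_right 0) (at_right 0)"
    using filterlim_powr_at_right_0[of \<alpha> "1 / \<alpha>" 1] \<alpha> by simp
  show "filterlim (\<lambda>t. t powr \<alpha> / \<alpha>) (at_right 0) (at_right 0)"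
    using filterlim_powr_at_right_0[of 1 \<alpha> \<alpha>] \<alpha> by simp
  show "\<forall>\<^sub>F s in at_right 0. ((\<alpha> * s) powr (1 / \<alpha>)) powr \<alpha> / \<alpha> = s"
    using \<alpha> by (intro eventually_mono[OF eventually_at_right_less]) (auto simp: powr_powr)
qed

lemma conformable_deriv_tendsto_iff:
  fixes v :: "real \<Rightarrow> 'a::real_normed_vector"
  assumes \<alpha>: "0 < \<alpha>" and v: "\<And>r. 0 < r \<Longrightarrow> v r = u (r powr \<alpha> / \<alpha>)"
  shows "(\<forall>\<^sub>F t in at_right 0. conformable_differentiable \<alpha> v t) \<and>
      ((\<lambda>t. conformable_deriv \<alpha> v t) \<longlongrightarrow> y) (at_right 0) \<longleftrightarrow>
    (\<exists>u'. (\<forall>\<^sub>F s in at_right 0. (u has_vector_derivative u' s) (at s)) \<and> (u' \<longlongrightarrow> y) (at_right 0))"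
    (is "?L \<longleftrightarrow> (\<exists>u'. ?R u')")
proof -
  define \<phi> where "\<phi> t = t powr \<alpha> / \<alpha>" for t
  have \<phi>: "filtermap \<phi> (at_right 0) = at_right 0"
    unfolding \<phi>_def using filtermap_powr_at_right_0[OF \<alpha>] .
  \<comment> \<open>A derivative \<open>u'\<close> of \<open>u\<close> in the variable s becomes the
    conformable derivative \<open>u' \<circ> \<phi>\<close> of \<open>v\<close>: the filter equality
    changes the variable, the chain rule the derivative.\<close>
  have R: "?R u' \<longleftrightarrow> (\<forall>\<^sub>F t in at_right 0. has_conformable_derivative \<alpha> v (u' (\<phi> t)) t) \<and>
      ((\<lambda>t. u' (\<phi> t)) \<longlongrightarrow> y) (at_right 0)" for u'
  proof -
    have "?R u' \<longleftrightarrow> (\<forall>\<^sub>F t in at_right 0. (u has_vector_derivative u' (\<phi> t)) (at (\<phi> t))) \<and>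
        ((\<lambda>t. u' (\<phi> t)) \<longlongrightarrow> y) (at_right 0)"
      using eventually_filtermap[of "\<lambda>s. (u has_vector_derivative u' s) (at s)" \<phi> "at_right 0"]
        filterlim_filtermap[of u' "nhds y" \<phi> "at_right 0"] unfolding \<phi> by simp
    moreover have "(\<forall>\<^sub>F t in at_right 0. (u has_vector_derivative u' (\<phi> t)) (at (\<phi> t))) \<longleftrightarrow>
        (\<forall>\<^sub>F t in at_right 0. has_conformable_derivative \<alpha> v (u' (\<phi> t)) t)"
      by (intro eventually_cong[OF eventually_at_right_less])
        (simp add: has_conformable_derivative_iff[where v = v and u = u, OF \<alpha> _ v] \<phi>_def)
    ultimately show ?thesis by simp
  qed
  show ?thesis
  proof
    assume L: ?L
    \<comment> \<open>The witness is the conformable derivative read in the variable s through the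
      inverse substitution.\<close>
    define u' where "u' s = conformable_deriv \<alpha> v ((\<alpha> * s) powr (1 / \<alpha>))" for s
    have inv: "u' (\<phi> t) = conformable_deriv \<alpha> v t" if "t > 0" for t
      using that \<alpha> by (simp add: u'_def \<phi>_def powr_powr)
    have "\<forall>\<^sub>F t in at_right 0. has_conformable_derivative \<alpha> v (u' (\<phi> t)) t"
      using conjunct1[OF L] eventually_at_right_less[of 0]
      by eventually_elim (simp add: inv conformable_deriv_works)
    moreover have "((\<lambda>t. u' (\<phi> t)) \<longlongrightarrow> y) (at_right 0)"
      by (rule Lim_transform_eventually[OF conjunct2[OF L]])
        (auto simp: inv intro!: eventually_mono[OF eventually_at_right_less])
    ultimately have "?R u'" unfolding R ..
    then show "\<exists>u'. ?R u'" by (rule exI[of _ u'])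
  next
    assume "\<exists>u'. ?R u'"
    then obtain u' where u': "\<forall>\<^sub>F t in at_right 0. has_conformable_derivative \<alpha> v (u' (\<phi> t)) t"
        "((\<lambda>t. u' (\<phi> t)) \<longlongrightarrow> y) (at_right 0)"
      unfolding R by blast
    show ?L
    proof
      show "\<forall>\<^sub>F t in at_right 0. conformable_differentiable \<alpha> v t"
        using u'(1) by (rule eventually_mono) (auto simp: conformable_differentiable_def)
      show "((\<lambda>t. conformable_deriv \<alpha> v t) \<longlongrightarrow> y) (at_right 0)"
        by (rule Lim_transform_eventually[OF u'(2)], rule eventually_mono[OF u'(1)])
          (simp add: has_conformable_derivative_imp_deriv)
    qed
  qed
qed

theorem lemma1:
  fixes \<alpha> :: real
    and T\<^sub>\<alpha> T :: "real \<Rightarrow> 'a::banach \<Rightarrow>\<^sub>L 'a"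
  assumes "0 < \<alpha>" and "\<alpha> \<le> 1"
    and "C0_alpha_semigroup \<alpha> T\<^sub>\<alpha>"
    and "\<And>s. s \<ge> 0 \<Longrightarrow> T s = T\<^sub>\<alpha> ((\<alpha> * s) powr (1 / \<alpha>))"
  shows "alpha_generator_domain \<alpha> T\<^sub>\<alpha> = generator_domain T \<and>
         (\<forall>x\<in>alpha_generator_domain \<alpha> T\<^sub>\<alpha>. alpha_generator \<alpha> T\<^sub>\<alpha> x = generator T x)"
proof -
  have T: "C0_alpha_semigroup 1 T"
    using C0_alpha_semigroup_rescale assms by blast
  have orbit: "blinfun_apply (T\<^sub>\<alpha> r) x = blinfun_apply (T (r powr \<alpha> / \<alpha>)) x" if "0 < r" for r x
    using assms(1) that by (simp add: assms(4) powr_powr)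
  \<comment> \<open>Stated for each y separately: existence of y will give equality of the domains,
    and the shared y equality of the values.\<close>
  have iff: "(\<forall>\<^sub>F t in at_right 0. conformable_differentiable \<alpha> (\<lambda>t. blinfun_apply (T\<^sub>\<alpha> t) x) t) \<and>
      ((\<lambda>t. conformable_deriv \<alpha> (\<lambda>t. blinfun_apply (T\<^sub>\<alpha> t) x) t) \<longlongrightarrow> y) (at_right 0) \<longleftrightarrow>
      ((\<lambda>s. (blinfun_apply (T s) x - x) /\<^sub>R s) \<longlongrightarrow> y) (at_right 0)" for x y
    unfolding C0_semigroup_generator_iff[OF T]
    by (rule conformable_deriv_tendsto_iff[OF assms(1)]) (rule orbit)
  \<comment> \<open>Eventual differentiability does not depend on y, so it moves out of the
    quantifier over y.\<close>
  have dom: "alpha_generator_domain \<alpha> T\<^sub>\<alpha> = generator_domain T"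
    unfolding alpha_generator_domain_def generator_domain_def iff[symmetric] by auto
  have "alpha_generator \<alpha> T\<^sub>\<alpha> x = generator T x" if x: "x \<in> generator_domain T" for x
  proof -
    obtain y where y: "((\<lambda>s. (blinfun_apply (T s) x - x) /\<^sub>R s) \<longlongrightarrow> y) (at_right 0)"
      using x by (auto simp: generator_domain_def)
    with iff[of x y] show ?thesis
      by (simp add: alpha_generator_def generator_def tendsto_Lim)
  qed
  with dom show ?thesis by simp
qed

end
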